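(* The hydrostatic reconstruction scheme (with any consistent numerical flux $\mathbf f^*$) applied to the multilayer shallow water equations preserves the lake-at-rest initial condition $$h_m\partial_x\Big(b+\sum_{k\ge m}h_k+\sum_{k<m}\sigma_{km}h_k\Big)=0,\qquad v_m=0,\qquad m=1,\dots,M;$$ that is, for every discrete lake-at-rest state the scheme gives $\frac{d}{dt}\mathbf u_i=0$ for all cells $i$.
   Context: Constants: $M\ge1$, $g>0$, densities $0<\rho_1<\dots<\rho_M$ (layers counted top to bottom), $\sigma_{km}=\rho_k/\rho_m$. Multilayer shallow water equations, $m=1,\dots,M$: $\partial_t h_m+\partial_x(h_mv_m)=0$, $\partial_t(h_mv_m)+\partial_x(h_mv_m^2)=-gh_m\partial_x\big(b+\sum_{k\ge m}h_k+\sum_{k<m}\sigma_{km}h_k\big)$. Write, layer by layer, $\mathbf u_m=(h_m,h_mv_m)^T$, $\mathbf f_m=(h_mv_m,h_mv_m^2)^T$, $\boldsymbol\phi_m=g(0,h_m)^T$, $\mathbf r_m=\big(0,\,b+\sum_{k\ge m}h_k+\sum_{k<m}\sigma_{km}h_k\big)^T$, and $\mathbf u,\mathbf f,\boldsymbol\phi,\mathbf r$ for the stacked vectors; $\circ$ is the Hadamard product. Grid and data: uniform one-dimensional cells (infinite or periodic grid) of size $\Delta x$ with constant values $b_i\in\mathbb R$, $h_{m,i}\ge0$, $v_{m,i}\in\mathbb R$; $H_{m}=b+\sum_{k\ge m}h_k$. At interface $i+\frac12$, superscript $-$ denotes values of cell $i$, $+$ of cell $i+1$; $[\![a]\!]=a^+-a^-$.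 Hydrostatic reconstruction at each interface: $b_\epsilon^\pm=\min(H_1^\pm,\max(b^-,b^+))$, $H_{m,\epsilon}^\pm=\max(H_m^\pm,b_\epsilon^\pm)$, $h_{M,\epsilon}^\pm=H_{M,\epsilon}^\pm-b_\epsilon^\pm$, $h_{m,\epsilon}^\pm=H_{m,\epsilon}^\pm-H_{m+1,\epsilon}^\pm$ for $m<M$, $\mathbf u_{m,\epsilon}^\pm=(h_{m,\epsilon}^\pm,h_{m,\epsilon}^\pm v_m^\pm)^T$; $\boldsymbol\phi_\epsilon^\pm,\mathbf r_\epsilon^\pm$ are $\boldsymbol\phi,\mathbf r$ evaluated with $h_{m,\epsilon}^\pm,b_\epsilon^\pm$. Hydrostatic reconstruction scheme: $$\Delta x\frac{d}{dt}\mathbf u_i=-\big(\mathbf f^*_{\epsilon,i+1/2}-\mathbf f^*_{\epsilon,i-1/2}\big)-\tfrac12\boldsymbol\phi^-_{\epsilon,i+1/2}\circ[\![\mathbf r_\epsilon]\!]_{i+1/2}-\tfrac12\boldsymbol\phi^+_{\epsilon,i-1/2}\circ[\![\mathbf r_\epsilon]\!]_{i-1/2},$$ where $\mathbf f^*_\epsilon$ is the numerical flux evaluated at the two reconstructed states $(h_{m,\epsilon}^\pm,v_m^\pm)_{m}$. Consistent means that the numerical flux of two identical states $(h_m,v_m)_m$ equals $\mathbf f$. Discrete lake-at-rest state: $v_{m,i}=0$ for all $m,i$, and at each interface there are constants $C_1\ge\dots\ge C_M$ with $H_m^-=\max(C_m,b^-)$ and $H_m^+=\max(C_m,b^+)$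 for all $m$ (each total layer height is constant where the layer is wet). *)

theory Defs
  imports "HOL-Analysis.Analysis"
begin

text \<open>
  Layers are numbered \<open>1..M\<close> from top to bottom; layer data are functions on \<^typ>\<open>nat\<close> of which
  only the values on \<open>{1..M}\<close> matter. Cells are numbered by \<^typ>\<open>int\<close>; a periodic grid is the
  special case of data that are periodic in the cell index. Cell data are written
  \<open>b i\<close>, \<open>h i m\<close>, \<open>v i m\<close> for cell \<open>i\<close> and layer \<open>m\<close>.
  A vector of the stacked system is a function from layers to pairs (mass component,
  momentum component).
\<close>

type_synonym column = "nat \<Rightarrow> real"
type_synonym stacked = "nat \<Rightarrow> real \<times> real"

definition hadamard :: "real \<times> real \<Rightarrow> real \<times> real \<Rightarrow> real \<times> real" where
  "hadamard x y = (fst x * fst y, snd x * snd y)"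

definition cons_vec :: "column \<Rightarrow> column \<Rightarrow> stacked" where
  "cons_vec h v m = (h m, h m * v m)"

definition flux_vec :: "column \<Rightarrow> column \<Rightarrow> stacked" where
  "flux_vec h v m = (h m * v m, h m * (v m)\<^sup>2)"

definition phi_vec :: "real \<Rightarrow> column \<Rightarrow> stacked" where
  "phi_vec g h m = g *\<^sub>R (0, h m)"

definition dens_ratio :: "(nat \<Rightarrow> real) \<Rightarrow> nat \<Rightarrow> nat \<Rightarrow> real" where
  "dens_ratio \<rho> k m = \<rho> k / \<rho> m"

definition r_vec :: "nat \<Rightarrow> (nat \<Rightarrow> real) \<Rightarrow> real \<Rightarrow> column \<Rightarrow> stacked" where
  "r_vec M \<rho> b h m =
     (0, b + (\<Sum>k=m..M. h k) + (\<Sum>k=1..<m. dens_ratio \<rho> k m * h k))"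

definition total_height :: "nat \<Rightarrow> real \<Rightarrow> column \<Rightarrow> nat \<Rightarrow> real" where
  "total_height M b h m = b + (\<Sum>k=m..M. h k)"


subsection \<open>Hydrostatic reconstruction\<close>

text \<open>
  In the next three definitions \<open>bL\<close>, \<open>bR\<close> are the bottom values on the two sides of an interface
  and \<open>b\<close>, \<open>h\<close> are the data of the side being reconstructed (so \<open>b\<close> is \<open>bL\<close> or \<open>bR\<close>).
\<close>

definition rec_bottom :: "nat \<Rightarrow> real \<Rightarrow> real \<Rightarrow> real \<Rightarrow> column \<Rightarrow> real" where
  "rec_bottom M bL bR b h = min (total_height M b h 1) (max bL bR)"

definition rec_height :: "nat \<Rightarrow> real \<Rightarrow> real \<Rightarrow> real \<Rightarrow> column \<Rightarrow> nat \<Rightarrow> real" where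
  "rec_height M bL bR b h m = max (total_height M b h m) (rec_bottom M bL bR b h)"

definition rec_depth :: "nat \<Rightarrow> real \<Rightarrow> real \<Rightarrow> real \<Rightarrow> column \<Rightarrow> column" where
  "rec_depth M bL bR b h m =
     (if m = M then rec_height M bL bR b h M - rec_bottom M bL bR b h
      else rec_height M bL bR b h m - rec_height M bL bR b h (m + 1))"

text \<open>
  Interface quantities with argument \<open>i\<close> live at the interface \<open>i + 1/2\<close> between the cells \<open>i\<close>
  (side \<open>-\<close>) and \<open>i + 1\<close> (side \<open>+\<close>).
\<close>

definition b_minus :: "nat \<Rightarrow> (int \<Rightarrow> real) \<Rightarrow> (int \<Rightarrow> column) \<Rightarrow> int \<Rightarrow> real" where
  "b_minus M b h i = rec_bottom M (b i) (b (i + 1)) (b i) (h i)"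

definition b_plus :: "nat \<Rightarrow> (int \<Rightarrow> real) \<Rightarrow> (int \<Rightarrow> column) \<Rightarrow> int \<Rightarrow> real" where
  "b_plus M b h i = rec_bottom M (b i) (b (i + 1)) (b (i + 1)) (h (i + 1))"

definition h_minus :: "nat \<Rightarrow> (int \<Rightarrow> real) \<Rightarrow> (int \<Rightarrow> column) \<Rightarrow> int \<Rightarrow> column" where
  "h_minus M b h i = rec_depth M (b i) (b (i + 1)) (b i) (h i)"

definition h_plus :: "nat \<Rightarrow> (int \<Rightarrow> real) \<Rightarrow> (int \<Rightarrow> column) \<Rightarrow> int \<Rightarrow> column" where
  "h_plus M b h i = rec_depth M (b i) (b (i + 1)) (b (i + 1)) (h (i + 1))"

definition jump_r ::
  "nat \<Rightarrow> (nat \<Rightarrow> real) \<Rightarrow> (int \<Rightarrow> real) \<Rightarrow> (int \<Rightarrow> column) \<Rightarrow> int \<Rightarrow> stacked" where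
  "jump_r M \<rho> b h i m =
     r_vec M \<rho> (b_plus M b h i) (h_plus M b h i) m
     - r_vec M \<rho> (b_minus M b h i) (h_minus M b h i) m"


subsection \<open>Numerical fluxes\<close>

text \<open>
  A numerical flux takes two states \<open>(h_m, v_m)\<close>, \<open>m = 1..M\<close>. Restricting to \<open>{1..M}\<close> makes
  a state an honest \<open>M\<close>-tuple, so that the irrelevant values outside \<open>{1..M}\<close> are not passed
  to the flux.
\<close>

type_synonym num_flux = "stacked \<Rightarrow> stacked \<Rightarrow> stacked"

definition layer_state :: "nat \<Rightarrow> column \<Rightarrow> column \<Rightarrow> stacked" where
  "layer_state M h v = (\<lambda>m\<in>{1..M}. (h m, v m))"

definition consistent_flux :: "nat \<Rightarrow> num_flux \<Rightarrow> bool" where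
  "consistent_flux M F \<longleftrightarrow>
     (\<forall>h v. (\<forall>m\<in>{1..M}. 0 \<le> h m) \<longrightarrow>
        (\<forall>m\<in>{1..M}. F (layer_state M h v) (layer_state M h v) m = flux_vec h v m))"

definition flux_rec ::
  "nat \<Rightarrow> num_flux \<Rightarrow> (int \<Rightarrow> real) \<Rightarrow> (int \<Rightarrow> column) \<Rightarrow> (int \<Rightarrow> column) \<Rightarrow> int \<Rightarrow> stacked" where
  "flux_rec M F b h v i =
     F (layer_state M (h_minus M b h i) (v i)) (layer_state M (h_plus M b h i) (v (i + 1)))"


subsection \<open>The scheme and the lake at rest\<close>

definition hr_rhs ::
  "nat \<Rightarrow> real \<Rightarrow> (nat \<Rightarrow> real) \<Rightarrow> num_flux \<Rightarrow> (int \<Rightarrow> real) \<Rightarrow> (int \<Rightarrow> column) \<Rightarrow> (int \<Rightarrow> column)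
    \<Rightarrow> int \<Rightarrow> stacked" where
  "hr_rhs M g \<rho> F b h v i m =
     - (flux_rec M F b h v i m - flux_rec M F b h v (i - 1) m)
     - (1/2) *\<^sub>R hadamard (phi_vec g (h_minus M b h i) m) (jump_r M \<rho> b h i m)
     - (1/2) *\<^sub>R hadamard (phi_vec g (h_plus M b h (i - 1)) m) (jump_r M \<rho> b h (i - 1) m)"

text \<open>
  The time-dependent data \<open>h s\<close>, \<open>v s\<close> satisfy the semi-discrete scheme at time \<open>t\<close>. The time
  domain \<open>T\<close> allows a one-sided derivative at an initial time.
\<close>

definition hr_scheme_at ::
  "nat \<Rightarrow> real \<Rightarrow> (nat \<Rightarrow> real) \<Rightarrow> num_flux \<Rightarrow> real \<Rightarrow> (int \<Rightarrow> real)
    \<Rightarrow> (real \<Rightarrow> int \<Rightarrow> column) \<Rightarrow> (real \<Rightarrow> int \<Rightarrow> column) \<Rightarrow> real set \<Rightarrow> real \<Rightarrow> bool" where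
  "hr_scheme_at M g \<rho> F dx b h v T t \<longleftrightarrow>
     (\<forall>i. \<forall>m\<in>{1..M}. \<exists>D.
        ((\<lambda>s. cons_vec (h s i) (v s i) m) has_vector_derivative D) (at t within T) \<and>
        dx *\<^sub>R D = hr_rhs M g \<rho> F b (h t) (v t) i m)"

definition lake_at_rest ::
  "nat \<Rightarrow> (int \<Rightarrow> real) \<Rightarrow> (int \<Rightarrow> column) \<Rightarrow> (int \<Rightarrow> column) \<Rightarrow> bool" where
  "lake_at_rest M b h v \<longleftrightarrow>
     (\<forall>i. \<forall>m\<in>{1..M}. v i m = 0) \<and>
     (\<forall>i. \<exists>C. antimono_on {1..M} C \<and>
        (\<forall>m\<in>{1..M}. total_height M (b i) (h i) m = max (C m) (b i) \<and>
           total_height M (b (i + 1)) (h (i + 1)) m = max (C m) (b (i + 1))))"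

end

theory Submission imports Defs begin

text \<open>
  Why the scheme is well balanced. Fix an interface of a lake at rest, with surface levels
  \<open>C 1 \<ge> \<dots> \<ge> C M\<close> and \<open>B = max bL bR\<close>, the higher of the two bottoms.

  If \<open>C 1 \<ge> B\<close>, both reconstructed bottoms are \<open>B\<close> and both reconstructed heights of layer \<open>m\<close> are
  \<open>max (C m) B\<close>, so the two reconstructed states coincide (\<open>rec_bottom_submerged\<close>,
  \<open>rec_depth_submerged\<close>) and \<open>\<lbrakk>r\<rbrakk> = 0\<close> term by term, whatever the density ratios.

  If \<open>C 1 < B\<close>, no layer reaches over the higher bottom. Then the reconstructed bottoms can differ, but
  all reconstructed depths vanish on both sides (\<open>rec_depth_emergent\<close>), hence so does the
  factor \<open>\<phi>\<close> that multiplies \<open>\<lbrakk>r\<rbrakk>\<close>.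

  In both cases the source terms vanish (\<open>source_at_rest\<close>) and the numerical flux is evaluated at two
  equal states with zero velocity, so that consistency makes it zero (\<open>flux_rec_at_rest\<close>).
\<close>

lemma rec_bottom_submerged:
  assumes "b \<le> max bL bR" and "max bL bR \<le> c"
    and "total_height M b h 1 = max c b"
  shows "rec_bottom M bL bR b h = max bL bR"
  using assms(1,2) unfolding rec_bottom_def assms(3) by (intro min.absorb2 max.coboundedI1)

lemma rec_depth_submerged:
  assumes "b \<le> max bL bR" and "max bL bR \<le> C 1"
    and "\<forall>m\<in>{1..M}. total_height M b h m = max (C m) b"
    and "m \<in> {1..M}"
  shows "rec_depth M bL bR b h m =
    max (C m) (max bL bR) - (if m = M then max bL bR else max (C (m + 1)) (max bL bR))"
proof -
  have bottom: "rec_bottom M bL bR b h = max bL bR"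
    using assms by (intro rec_bottom_submerged[where c = "C 1"]) auto
  have "rec_height M bL bR b h k = max (C k) (max bL bR)" if "k \<in> {1..M}" for k
    using assms(1,3) that by (simp add: rec_height_def bottom)
  with assms(4) bottom show ?thesis by (simp add: rec_depth_def)
qed

text \<open>
  Where the surface level lies below the higher bottom, the reconstructed bottom is the top height
  \<open>max (C 1) b\<close> of the column itself, so all reconstructed heights collapse to it.
\<close>

lemma rec_depth_emergent:
  assumes "b \<le> max bL bR" and "C 1 < max bL bR"
    and anti: "antimono_on {1..M} C"
    and "\<forall>m\<in>{1..M}. total_height M b h m = max (C m) b"
    and "m \<in> {1..M}"
  shows "rec_depth M bL bR b h m = 0"
proof -
  have bottom: "rec_bottom M bL bR b h = max (C 1) b"
    using assms(1,2,4,5) by (simp add: rec_bottom_def)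
  have "rec_height M bL bR b h k = max (C 1) b" if k: "k \<in> {1..M}" for k
  proof -
    have "C k \<le> C 1" using monotone_onD[OF anti, of 1 k] k by auto
    then show ?thesis using assms(4) k by (simp add: rec_height_def bottom)
  qed
  with assms(5) bottom show ?thesis by (simp add: rec_depth_def)
qed

text \<open>
  The dichotomy at an interface: equal nonnegative depths on the two sides, and either equal
  reconstructed bottoms or no reconstructed water at all.
\<close>

lemma reconstruction_at_rest:
  assumes rest: "lake_at_rest M b h v"
  shows "\<forall>m\<in>{1..M}. h_minus M b h i m = h_plus M b h i m \<and> 0 \<le> h_minus M b h i m"
    and "b_minus M b h i = b_plus M b h i \<or> (\<forall>m\<in>{1..M}. h_minus M b h i m = 0)"
proof -
  obtain C where anti: "antimono_on {1..M} C"
    and L: "\<forall>m\<in>{1..M}. total_height M (b i) (h i) m = max (C m) (b i)"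
    and R: "\<forall>m\<in>{1..M}. total_height M (b (i + 1)) (h (i + 1)) m = max (C m) (b (i + 1))"
    using rest unfolding lake_at_rest_def by meson
  let ?B = "max (b i) (b (i + 1))"
  have "(\<forall>m\<in>{1..M}. h_minus M b h i m = h_plus M b h i m \<and> 0 \<le> h_minus M b h i m) \<and>
    (b_minus M b h i = b_plus M b h i \<or> (\<forall>m\<in>{1..M}. h_minus M b h i m = 0))"
  proof (cases "?B \<le> C 1")
    case True
    have depths: "h_minus M b h i m = h_plus M b h i m \<and> 0 \<le> h_minus M b h i m"
      if m: "m \<in> {1..M}" for m
    proof -
      have "C (m + 1) \<le> C m" if "m \<noteq> M"
        using monotone_onD[OF anti, of m "m + 1"] m that by auto
      then show ?thesis
        unfolding h_minus_def h_plus_def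
          rec_depth_submerged[OF max.cobounded1 True L m]
          rec_depth_submerged[OF max.cobounded2 True R m]
        by (auto intro: max.mono)
    qed
    have "b_minus M b h i = b_plus M b h i" if "1 \<le> M"
      using rec_bottom_submerged[OF _ True, of "b i" M "h i"] L that
        rec_bottom_submerged[OF _ True, of "b (i + 1)" M "h (i + 1)"] R
      by (simp add: b_minus_def b_plus_def)
    with depths show ?thesis by fastforce
  next
    case False
    then have "C 1 < ?B" by linarith
    from rec_depth_emergent[OF _ this anti L] rec_depth_emergent[OF _ this anti R]
    show ?thesis by (simp add: h_minus_def h_plus_def)
  qed
  then show "\<forall>m\<in>{1..M}. h_minus M b h i m = h_plus M b h i m \<and> 0 \<le> h_minus M b h i m"
    and "b_minus M b h i = b_plus M b h i \<or> (\<forall>m\<in>{1..M}. h_minus M b h i m = 0)"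
    by blast+
qed

lemma flux_rec_at_rest:
  assumes cons: "consistent_flux M F" and rest: "lake_at_rest M b h v" and m: "m \<in> {1..M}"
  shows "flux_rec M F b h v i m = 0"
proof -
  let ?h = "h_minus M b h i"
  note rec = reconstruction_at_rest(1)[OF rest, of i]
  have still: "\<forall>j. \<forall>m\<in>{1..M}. v j m = 0"
    using rest by (simp add: lake_at_rest_def)
  have "layer_state M (h_plus M b h i) (v (i + 1)) = layer_state M ?h (v i)"
    unfolding layer_state_def using rec still by (intro restrict_ext) simp
  then have "flux_rec M F b h v i m = flux_vec ?h (v i) m"
    using cons rec m unfolding flux_rec_def consistent_flux_def by metis
  also have "\<dots> = 0"
    using still m by (simp add: flux_vec_def zero_prod_def)
  finally show ?thesis .
qed

lemma source_at_rest:
  assumes rest: "lake_at_rest M b h v" and m: "m \<in> {1..M}"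
  shows "hadamard (phi_vec g (h_minus M b h i) m) (jump_r M \<rho> b h i m) = 0"
    and "hadamard (phi_vec g (h_plus M b h i) m) (jump_r M \<rho> b h i m) = 0"
proof -
  note rec = reconstruction_at_rest[OF rest, of i]
  have "h_minus M b h i m = 0 \<or> jump_r M \<rho> b h i m = 0"
  proof (cases "b_minus M b h i = b_plus M b h i")
    case True
    have "(\<Sum>k=m..M. h_plus M b h i k) = (\<Sum>k=m..M. h_minus M b h i k)"
      and "(\<Sum>k=1..<m. dens_ratio \<rho> k m * h_plus M b h i k)
        = (\<Sum>k=1..<m. dens_ratio \<rho> k m * h_minus M b h i k)"
      using rec(1) m by (auto intro!: sum.cong)
    with True have "jump_r M \<rho> b h i m = 0"
      by (simp add: jump_r_def r_vec_def zero_prod_def)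
    then show ?thesis ..
  next
    case False
    with rec(2) m show ?thesis by blast
  qed
  with rec(1) m
  show "hadamard (phi_vec g (h_minus M b h i) m) (jump_r M \<rho> b h i m) = 0"
    and "hadamard (phi_vec g (h_plus M b h i) m) (jump_r M \<rho> b h i m) = 0"
    by (auto simp: hadamard_def phi_vec_def zero_prod_def)
qed

lemma hr_rhs_at_rest:
  assumes "consistent_flux M F" and "lake_at_rest M b h v" and "m \<in> {1..M}"
  shows "hr_rhs M g \<rho> F b h v i m = 0"
  using assms by (simp add: hr_rhs_def flux_rec_at_rest source_at_rest)

theorem lemma3:
  fixes M :: nat and g dx :: real and \<rho> :: "nat \<Rightarrow> real" and F :: num_flux
    and b :: "int \<Rightarrow> real"
  assumes "1 \<le> M" and "0 < g" and "0 < dx"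
    and "\<forall>m\<in>{1..M}. 0 < \<rho> m" and "strict_mono_on {1..M} \<rho>"
    and "consistent_flux M F"
  shows
    "(\<forall>h v T t.
        (\<forall>i. \<forall>m\<in>{1..M}. 0 \<le> h t i m) \<and> lake_at_rest M b (h t) (v t) \<and>
        hr_scheme_at M g \<rho> F dx b h v T t \<longrightarrow>
        (\<forall>i. \<forall>m\<in>{1..M}.
           ((\<lambda>s. cons_vec (h s i) (v s i) m) has_vector_derivative 0) (at t within T))) \<and>
     (\<forall>h\<^sub>0 v\<^sub>0 T t.
        (\<forall>i. \<forall>m\<in>{1..M}. 0 \<le> h\<^sub>0 i m) \<and> lake_at_rest M b h\<^sub>0 v\<^sub>0 \<longrightarrow>
        hr_scheme_at M g \<rho> F dx b (\<lambda>_. h\<^sub>0) (\<lambda>_. v\<^sub>0) T t)"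
proof (intro conjI allI impI ballI)
  fix h v :: "real \<Rightarrow> int \<Rightarrow> column" and T :: "real set" and t :: real and i :: int and m :: nat
  assume sol: "(\<forall>i. \<forall>m\<in>{1..M}. 0 \<le> h t i m) \<and> lake_at_rest M b (h t) (v t) \<and>
    hr_scheme_at M g \<rho> F dx b h v T t" and m: "m \<in> {1..M}"
  then obtain D
    where D: "((\<lambda>s. cons_vec (h s i) (v s i) m) has_vector_derivative D) (at t within T)"
      and "dx *\<^sub>R D = hr_rhs M g \<rho> F b (h t) (v t) i m"
    unfolding hr_scheme_at_def by meson
  then have "D = 0"
    using hr_rhs_at_rest[OF assms(6) _ m] sol \<open>0 < dx\<close> by simp
  with D show "((\<lambda>s. cons_vec (h s i) (v s i) m) has_vector_derivative 0) (at t within T)"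
    by simp
next
  fix h\<^sub>0 v\<^sub>0 :: "int \<Rightarrow> column" and T :: "real set" and t :: real
  assume rest: "(\<forall>i. \<forall>m\<in>{1..M}. 0 \<le> h\<^sub>0 i m) \<and> lake_at_rest M b h\<^sub>0 v\<^sub>0"
  show "hr_scheme_at M g \<rho> F dx b (\<lambda>_. h\<^sub>0) (\<lambda>_. v\<^sub>0) T t"
    unfolding hr_scheme_at_def
  proof (intro allI ballI exI conjI)
    fix i :: int and m :: nat
    assume "m \<in> {1..M}"
    then show "dx *\<^sub>R 0 = hr_rhs M g \<rho> F b h\<^sub>0 v\<^sub>0 i m"
      using hr_rhs_at_rest[OF assms(6)] rest by simp
  qed (rule has_vector_derivative_const)
qed

end
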